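(* Let $V:\mathbb{R}\to\mathbb{R}$ and $W:\mathbb{R}\to\mathbb{R}$ be functions with $W(x)=W(-x)$ for all $x$, and let $\Omega=[a,b]$ be partitioned into $N$ (possibly nonuniform) cells as in the context. For $n\ge1$ and a time step $\tau>0$, let $\rho^{n+1}=(\rho^{n+1}_1,\dots,\rho^{n+1}_N)$ be obtained from $\rho^n$ and $\rho^{n-1}$ by the two-step scheme $$\frac{\rho^*_j-\rho^n_j}{\tau/2}=\frac{C^*_{j+1/2}-C^*_{j-1/2}}{h_j},\qquad \rho^{n+1}_j=2\rho^*_j-\rho^n_j,\qquad j=1,\dots,N,$$ with the fluxes $C^*_{j+1/2}$ defined in the context. Then: (1) Conservation of mass: with the initialization of $\rho^0$ and $\rho^1$ described in the context, $$\sum_{j=1}^Nh_j\rho^n_j=\int_\Omega\rho_0(x)\,dx\qquad\text{for } n\ge1.$$ (2) Positivity preserving: if $\rho^n_j\ge0$ for all $j=1,\dots,N$, then $\rho^{n+1}_j\ge0$ for all $j=1,\dots,N$, provided $\tau$ is sufficiently small (i.e., for given $\rho^{n-1}$ and $\rho^n$ with $\rho^n_j\ge 0$ for all $j$ there is $\tau_0>0$ such that the conclusion holds for every $\tau\in(0,\tau_0)$).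
   Context: Mesh: $\Omega=[a,b]$ is partitioned into cells $I_j=[x_{j-1/2},x_{j+1/2}]$, $j=1,\dots,N$, with $x_{1/2}=a$, $x_{N+1/2}=b$, sizes $h_j=|I_j|>0$, and centers $x_j=x_{j-1/2}+\frac12h_j$. Set $h_{j+1/2}=(h_j+h_{j+1})/2$. For $x\in\mathbb{R}$ and $v\in\mathbb{R}^N$ define $$Q_1(x,v)=\exp\Big(-V(x)-\sum_{i=1}^Nh_iW(x_i-x)v_i\Big).$$ In the two-step scheme, $$M^*_{j+1/2}=Q_1\big(x_{j+1/2},\tfrac32\rho^n-\tfrac12\rho^{n-1}\big),\qquad M^*_j=Q_1\big(x_j,\tfrac32\rho^n-\tfrac12\rho^{n-1}\big),$$ $$C^*_{j+1/2}=\frac{M^*_{j+1/2}}{h_{j+1/2}}\left(\frac{\rho^*_{j+1}}{M^*_{j+1}}-\frac{\rho^*_j}{M^*_j}\right)\ \ (j=1,\dots,N-1),\qquad C^*_{1/2}=C^*_{N+1/2}=0,$$ so the first equation is a linear system for $\rho^*$. Initialization: $\rho^0_j=\frac1{h_j}\int_{I_j}\rho_0(x)\,dx$ for the (integrable) initial datum $\rho_0$, and $\rho^1$ is computed from $\rho^0$ by one step of the first order scheme $$\frac{\rho^1_j-\rho^0_j}{\tau}=\frac{C^{0,*}_{j+1/2}-C^{0,*}_{j-1/2}}{h_j},\qquad C^{0,*}_{j+1/2}=\frac{Q_1(x_{j+1/2},\rho^0)}{h_{j+1/2}}\left(\frac{\rho^1_{j+1}}{Q_1(x_{j+1},\rho^0)}-\frac{\rho^1_j}{Q_1(x_j,\rho^0)}\right)\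 (1\le j\le N-1),$$ with $C^{0,*}_{1/2}=C^{0,*}_{N+1/2}=0$. *)

theory Defs
  imports "HOL-Analysis.Analysis"
begin

text \<open>
  A mesh is given by its interfaces: \<open>xh j\<close> stands for $x_{j+1/2}$ with \<open>0 \<le> j \<le> N\<close>, so the
  cell $I_j$ lies between \<open>xh (j - 1)\<close> and \<open>xh j\<close> for \<open>1 \<le> j \<le> N\<close>.  Grid functions
  (vectors in $R^N$) have type \<open>nat \<Rightarrow> real\<close>; only the indices \<open>1..N\<close> matter.
\<close>

definition is_mesh :: "real \<Rightarrow> real \<Rightarrow> nat \<Rightarrow> (nat \<Rightarrow> real) \<Rightarrow> bool" where
  "is_mesh a b N xh \<longleftrightarrow>
     1 \<le> N \<and> xh 0 = a \<and> xh N = b \<and> (\<forall>j\<in>{1..N}. xh (j - 1) < xh j)"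

definition cell :: "(nat \<Rightarrow> real) \<Rightarrow> nat \<Rightarrow> real set" where
  "cell xh j = {xh (j - 1)..xh j}"

definition cell_size :: "(nat \<Rightarrow> real) \<Rightarrow> nat \<Rightarrow> real" where
  "cell_size xh j = xh j - xh (j - 1)"

definition cell_center :: "(nat \<Rightarrow> real) \<Rightarrow> nat \<Rightarrow> real" where
  "cell_center xh j = xh (j - 1) + cell_size xh j / 2"

text \<open>\<open>half_size xh j\<close> is $h_{j+1/2}$.\<close>

definition half_size :: "(nat \<Rightarrow> real) \<Rightarrow> nat \<Rightarrow> real" where
  "half_size xh j = (cell_size xh j + cell_size xh (j + 1)) / 2"

definition Q1 ::
  "(real \<Rightarrow> real) \<Rightarrow> (real \<Rightarrow> real) \<Rightarrow> nat \<Rightarrow> (nat \<Rightarrow> real) \<Rightarrow> real \<Rightarrow> (nat \<Rightarrow> real) \<Rightarrow> real"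
where
  "Q1 V W N xh x v =
     exp (- V x - (\<Sum>i=1..N. cell_size xh i * W (cell_center xh i - x) * v i))"

text \<open>
  \<open>flux V W N xh v u j\<close> is the flux at $x_{j+1/2}$ of the grid function \<open>u\<close>, with the coefficients
  $M$ evaluated at the grid function \<open>v\<close>.  The \<open>else\<close> branch is the zero flux at the two
  boundary interfaces \<open>j = 0\<close> and \<open>j = N\<close>.
\<close>

definition flux ::
  "(real \<Rightarrow> real) \<Rightarrow> (real \<Rightarrow> real) \<Rightarrow> nat \<Rightarrow> (nat \<Rightarrow> real) \<Rightarrow>
     (nat \<Rightarrow> real) \<Rightarrow> (nat \<Rightarrow> real) \<Rightarrow> nat \<Rightarrow> real"
where
  "flux V W N xh v u j =
     (if 1 \<le> j \<and> j < N then
        Q1 V W N xh (xh j) v / half_size xh j *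
          (u (j + 1) / Q1 V W N xh (cell_center xh (j + 1)) v
           - u j / Q1 V W N xh (cell_center xh j) v)
      else 0)"

definition first_order_step ::
  "(real \<Rightarrow> real) \<Rightarrow> (real \<Rightarrow> real) \<Rightarrow> nat \<Rightarrow> (nat \<Rightarrow> real) \<Rightarrow> real \<Rightarrow>
     (nat \<Rightarrow> real) \<Rightarrow> (nat \<Rightarrow> real) \<Rightarrow> bool"
where
  "first_order_step V W N xh \<tau> r r' \<longleftrightarrow>
     (\<forall>j\<in>{1..N}. (r' j - r j) / \<tau> =
        (flux V W N xh r r' j - flux V W N xh r r' (j - 1)) / cell_size xh j)"

text \<open>
  \<open>two_step_scheme V W N xh \<tau> rp r r'\<close>: the values \<open>r'\<close> at level $n+1$ are obtained from \<open>r\<close>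
  at level $n$ and \<open>rp\<close> at level $n-1$; \<open>rs\<close> is the intermediate solution $\rho^*$.
\<close>

definition two_step_scheme ::
  "(real \<Rightarrow> real) \<Rightarrow> (real \<Rightarrow> real) \<Rightarrow> nat \<Rightarrow> (nat \<Rightarrow> real) \<Rightarrow> real \<Rightarrow>
     (nat \<Rightarrow> real) \<Rightarrow> (nat \<Rightarrow> real) \<Rightarrow> (nat \<Rightarrow> real) \<Rightarrow> bool"
where
  "two_step_scheme V W N xh \<tau> rp r r' \<longleftrightarrow>
     (\<exists>rs. let v = (\<lambda>i. 3 / 2 * r i - 1 / 2 * rp i) in
        \<forall>j\<in>{1..N}.
          (rs j - r j) / (\<tau> / 2) =
            (flux V W N xh v rs j - flux V W N xh v rs (j - 1)) / cell_size xh j \<and>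
          r' j = 2 * rs j - r j)"

definition cell_averages ::
  "nat \<Rightarrow> (nat \<Rightarrow> real) \<Rightarrow> (real \<Rightarrow> real) \<Rightarrow> (nat \<Rightarrow> real) \<Rightarrow> bool"
where
  "cell_averages N xh \<rho>0 r \<longleftrightarrow>
     (\<forall>j\<in>{1..N}. r j = 1 / cell_size xh j * (LINT x:cell xh j|lebesgue. \<rho>0 x))"

end

theory Submission
  imports Defs
begin

text \<open>
  Both claims follow from the flux form of the scheme.  Summed over the cells with weights
  \<open>cell_size\<close>, the right-hand side telescopes to the difference of the two boundary fluxes, which
  vanish.  Hence a step with step size \<open>\<tau>\<close>, or the half step to $\rho^*$, keeps the mass, and so
  does the extrapolation $2\rho^* - \rho^n$.  The initial cell averages carry the mass of the
  initial datum because integrals over adjacent intervals add up.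

  For positivity, write the flux as $F_{j+1/2} = k_j (g_{j+1} - g_j)$ with $g_j = \rho^*_j / M^*_j$
  and $k_j \ge 0$.  At a cell where \<open>g\<close> is minimal, the net flux is nonnegative, so
  $\rho^*_j \ge \rho^n_j \ge 0$ there; as $M^* > 0$, the minimum of \<open>g\<close>, and so all of $\rho^*$, is
  nonnegative, for every time step (\<open>implicit_step_nonneg\<close>).  The new value is
  $\rho^*_j + (\rho^*_j - \rho^n_j)$, and the increment $\rho^*_j - \rho^n_j$ is a net flux in
  which only the outflow terms, proportional to $\tau \rho^*_j$, are negative.  For small
  \<open>\<tau>\<close> they are dominated by the first $\rho^*_j$ (\<open>extrapolated_step_nonneg\<close>).  The bound on
  \<open>\<tau>\<close> involves the mesh and the coefficients $M^*$ only, and these depend on $\rho^n$ and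
  $\rho^{n-1}$ but not on \<open>\<tau>\<close>.
\<close>

section \<open>Conservation of mass\<close>

lemma cell_size_pos:
  assumes "is_mesh a b N xh" "j \<in> {1..N}"
  shows "cell_size xh j > 0"
  using assms by (auto simp: is_mesh_def cell_size_def)

lemma zero_boundary_flux_mass:
  fixes h u u' F :: "nat \<Rightarrow> real"
  assumes h: "\<And>j. j \<in> {1..N} \<Longrightarrow> h j > 0"
    and s: "s \<noteq> 0"
    and step: "\<And>j. j \<in> {1..N} \<Longrightarrow> (u' j - u j) / s = (F j - F (j - 1)) / h j"
    and bdry: "F 0 = 0" "F N = 0"
  shows "(\<Sum>j=1..N. h j * u' j) = (\<Sum>j=1..N. h j * u j)"
proof -
  have "h j * u' j - h j * u j = s * (F j - F (j - 1))" if "j \<in> {1..N}" for j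
    using h[OF that] s step[OF that] by (simp add: field_simps)
  then have "(\<Sum>j=1..N. h j * u' j) - (\<Sum>j=1..N. h j * u j) = s * (\<Sum>j=1..N. F j - F (j - 1))"
    by (simp add: sum_subtractf[symmetric] sum_distrib_left)
  also have "(\<Sum>j=1..N. F j - F (j - 1)) = F N - F 0"
    using sum_telescope''[of 0 N F] by simp
  finally show ?thesis using bdry by simp
qed

lemma flux_boundary: "flux V W N xh v u 0 = 0" "flux V W N xh v u N = 0"
  by (simp_all add: flux_def)

lemma first_order_step_mass:
  assumes mesh: "is_mesh a b N xh" and \<tau>: "\<tau> > 0"
    and step: "first_order_step V W N xh \<tau> r r'"
  shows "(\<Sum>j=1..N. cell_size xh j * r' j) = (\<Sum>j=1..N. cell_size xh j * r j)"
  by (rule zero_boundary_flux_mass[where s = \<tau> and F = "flux V W N xh r r'"])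
     (use \<tau> step cell_size_pos[OF mesh] in \<open>auto simp: first_order_step_def flux_boundary\<close>)

lemma two_step_scheme_mass:
  assumes mesh: "is_mesh a b N xh" and \<tau>: "\<tau> > 0"
    and step: "two_step_scheme V W N xh \<tau> rp r r'"
  shows "(\<Sum>j=1..N. cell_size xh j * r' j) = (\<Sum>j=1..N. cell_size xh j * r j)"
proof -
  define v where "v = (\<lambda>i. 3 / 2 * r i - 1 / 2 * rp i)"
  obtain rs where
    rs: "\<And>j. j \<in> {1..N} \<Longrightarrow> (rs j - r j) / (\<tau> / 2) =
      (flux V W N xh v rs j - flux V W N xh v rs (j - 1)) / cell_size xh j"
    and r': "\<And>j. j \<in> {1..N} \<Longrightarrow> r' j = 2 * rs j - r j"
    using step unfolding two_step_scheme_def Let_def v_def by blast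
  have "(\<Sum>j=1..N. cell_size xh j * rs j) = (\<Sum>j=1..N. cell_size xh j * r j)"
    by (rule zero_boundary_flux_mass[where s = "\<tau> / 2" and F = "flux V W N xh v rs"])
       (use \<tau> rs cell_size_pos[OF mesh] flux_boundary in auto)
  moreover have "(\<Sum>j=1..N. cell_size xh j * r' j) =
      (\<Sum>j=1..N. 2 * (cell_size xh j * rs j) - cell_size xh j * r j)"
    by (rule sum.cong) (auto simp: r' algebra_simps)
  ultimately show ?thesis
    by (simp add: sum_subtractf sum_distrib_left[symmetric])
qed

lemma mesh_mono:
  assumes mesh: "is_mesh a b N xh" and "i \<le> j" "j \<le> N"
  shows "xh i \<le> xh j"
  using assms(2,3)
proof (induction j rule: dec_induct)
  case (step n)
  then have "xh n < xh (Suc n)"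
    using mesh unfolding is_mesh_def by (metis One_nat_def Suc_le_eq atLeastAtMost_iff diff_Suc_1 zero_less_Suc)
  then show ?case using step by simp
qed simp

lemma sum_integral_cells:
  fixes f :: "real \<Rightarrow> real"
  assumes mesh: "is_mesh a b N xh" and int: "set_integrable lebesgue {a..b} f"
  shows "(\<Sum>j=1..N. LINT x:cell xh j|lebesgue. f x) = (LINT x:{a..b}|lebesgue. f x)"
proof -
  have ends: "xh 0 = a" "xh N = b" using mesh by (auto simp: is_mesh_def)
  have sub: "set_integrable lebesgue {xh i..xh j} f" if "i \<le> j" "j \<le> N" for i j
  proof (rule set_integrable_subset[OF int])
    show "{xh i..xh j} \<subseteq> {a..b}"
      using mesh_mono[OF mesh, of 0 i] mesh_mono[OF mesh, of j N] that ends by auto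
  qed simp
  \<comment> \<open>The Lebesgue integral agrees with the gauge integral, for which intervals that share an
     endpoint can be joined.\<close>
  have "(\<Sum>j=1..n. LINT x:cell xh j|lebesgue. f x) = integral {xh 0..xh n} f" if "n \<le> N" for n
    using that
  proof (induction n)
    case (Suc n)
    have "integral {xh 0..xh n} f + integral {xh n..xh (Suc n)} f = integral {xh 0..xh (Suc n)} f"
    proof (rule Henstock_Kurzweil_Integration.integral_combine)
      show "xh 0 \<le> xh n" "xh n \<le> xh (Suc n)"
        using mesh_mono[OF mesh] Suc.prems by auto
      show "f integrable_on {xh 0..xh (Suc n)}"
        using set_lebesgue_integral_eq_integral(1)[OF sub[of 0 "Suc n"]] Suc.prems by simp
    qed
    moreover have "(LINT x:cell xh (Suc n)|lebesgue. f x) = integral {xh n..xh (Suc n)} f"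
      using set_lebesgue_integral_eq_integral(2)[OF sub[of n "Suc n"]] Suc.prems
      by (simp add: cell_def)
    ultimately show ?case using Suc by simp
  qed simp
  from this[of N] show ?thesis
    using set_lebesgue_integral_eq_integral(2)[OF int] ends by simp
qed

lemma cell_averages_mass:
  assumes mesh: "is_mesh a b N xh" and int: "set_integrable lebesgue {a..b} \<rho>0"
    and avg: "cell_averages N xh \<rho>0 r"
  shows "(\<Sum>j=1..N. cell_size xh j * r j) = (LINT x:{a..b}|lebesgue. \<rho>0 x)"
proof -
  have "cell_size xh j * r j = (LINT x:cell xh j|lebesgue. \<rho>0 x)" if "j \<in> {1..N}" for j
    using avg cell_size_pos[OF mesh that] that by (simp add: cell_averages_def)
  then show ?thesis
    using sum_integral_cells[OF mesh int] by simp
qed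

lemma two_step_mass_conservation:
  fixes \<rho> :: "nat \<Rightarrow> nat \<Rightarrow> real"
  assumes mesh: "is_mesh a b N xh" and \<tau>: "\<tau> > 0"
    and int: "set_integrable lebesgue {a..b} \<rho>0"
    and avg: "cell_averages N xh \<rho>0 (\<rho> 0)"
    and first: "first_order_step V W N xh \<tau> (\<rho> 0) (\<rho> 1)"
    and steps: "\<And>n. n \<ge> 1 \<Longrightarrow> two_step_scheme V W N xh \<tau> (\<rho> (n - 1)) (\<rho> n) (\<rho> (n + 1))"
    and n: "n \<ge> 1"
  shows "(\<Sum>j=1..N. cell_size xh j * \<rho> n j) = (LINT x:{a..b}|lebesgue. \<rho>0 x)"
  using n
proof (induction n rule: dec_induct)
  case base
  show ?case
    using first_order_step_mass[OF mesh \<tau> first] cell_averages_mass[OF mesh int avg] by simp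
next
  case (step n)
  then show ?case
    using two_step_scheme_mass[OF mesh \<tau> steps[of n]] by simp
qed

section \<open>Positivity\<close>

text \<open>
  A discrete minimum principle: the matrix of the implicit step is an M-matrix.  In terms of
  \<open>g j = u j / m j\<close>, the net flux into a cell with minimal \<open>g\<close> is nonnegative, and
  \<open>k 0 = 0 = k N\<close> makes this true also for the first and the last cell.
\<close>

lemma implicit_step_nonneg:
  fixes h k m r u :: "nat \<Rightarrow> real"
  assumes h: "\<And>j. j \<in> {1..N} \<Longrightarrow> h j > 0"
    and m: "\<And>j. m j > 0"
    and k: "\<And>j. k j \<ge> 0" "k 0 = 0" "k N = 0"
    and s: "s > 0"
    and r: "\<And>j. j \<in> {1..N} \<Longrightarrow> r j \<ge> 0"
    and F: "\<And>j. F j = k j * (u (j + 1) / m (j + 1) - u j / m j)"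
    and step: "\<And>j. j \<in> {1..N} \<Longrightarrow> (u j - r j) / s = (F j - F (j - 1)) / h j"
    and j: "j \<in> {1..N}"
  shows "u j \<ge> 0"
proof -
  define g where "g j = u j / m j" for j
  define i where "i = arg_min_on g {1..N}"
  have i: "i \<in> {1..N}" and least: "\<And>l. l \<in> {1..N} \<Longrightarrow> g i \<le> g l"
    using j arg_min_if_finite(1)[of "{1..N}" g] arg_min_least[of "{1..N}" _ g]
    unfolding i_def by auto
  have "F i \<ge> 0"
  proof (cases "i = N")
    case False
    then have "g i \<le> g (i + 1)" using i least[of "i + 1"] by simp
    then show ?thesis by (simp add: F k(1) flip: g_def)
  qed (simp add: F k)
  moreover have "F (i - 1) \<le> 0"
  proof (cases "i = 1")
    case False
    then have "g i \<le> g (i - 1)" using i by (intro least) auto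
    then show ?thesis using i by (simp add: F k(1) mult_nonneg_nonpos flip: g_def)
  qed (simp add: F k)
  ultimately have "(u i - r i) / s \<ge> 0"
    using h[OF i] step[OF i] by simp
  then have "u i \<ge> 0" using r[OF i] s by (simp add: zero_le_divide_iff)
  then have "g i \<ge> 0" using m[of i] by (simp add: g_def)
  then have "g j \<ge> 0" using least[OF j] by simp
  then show ?thesis using m[of j] by (simp add: g_def zero_le_divide_iff)
qed

text \<open>
  The extrapolated value is \<open>2 * u j - r j = u j + (u j - r j)\<close>.  Dropping the inflow from the
  neighbours, which is nonnegative because \<open>u\<close> is, bounds the increment below by
  \<open>- s * (k j + k (j - 1)) / (h j * m j) * u j\<close>, and the bound on \<open>s\<close> makes this at least
  \<open>- u j\<close>.
\<close>

lemma extrapolated_step_nonneg: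
  fixes h k m r u :: "nat \<Rightarrow> real"
  assumes h: "\<And>j. j \<in> {1..N} \<Longrightarrow> h j > 0"
    and m: "\<And>j. m j > 0"
    and k: "\<And>j. k j \<ge> 0" "k 0 = 0" "k N = 0"
    and s: "s > 0"
    and r: "\<And>j. j \<in> {1..N} \<Longrightarrow> r j \<ge> 0"
    and F: "\<And>j. F j = k j * (u (j + 1) / m (j + 1) - u j / m j)"
    and step: "\<And>j. j \<in> {1..N} \<Longrightarrow> (u j - r j) / s = (F j - F (j - 1)) / h j"
    and j: "j \<in> {1..N}"
    and small: "s * ((k j + k (j - 1)) / (h j * m j)) \<le> 1"
  shows "2 * u j - r j \<ge> 0"
proof -
  have u: "u i \<ge> 0" if "i \<in> {1..N}" for i
    using implicit_step_nonneg[OF h m k s r F step that] .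
  have right: "k j * (u (j + 1) / m (j + 1)) \<ge> 0"
  proof (cases "j = N")
    case False
    then show ?thesis using j u[of "j + 1"] m[of "j + 1"] k(1)[of j] by simp
  qed (simp add: k)
  have left: "k (j - 1) * (u (j - 1) / m (j - 1)) \<ge> 0"
  proof (cases "j = 1")
    case False
    then have "u (j - 1) \<ge> 0" using j by (intro u) auto
    then show ?thesis using m[of "j - 1"] k(1)[of "j - 1"] by simp
  qed (simp add: k)
  have "- u j \<le> - (s * ((k j + k (j - 1)) / (h j * m j)) * u j)"
    using mult_right_mono[OF small u[OF j]] by simp
  also have "\<dots> = s / h j * - ((k j + k (j - 1)) * (u j / m j))"
    by simp
  also have "\<dots> \<le> s / h j * (F j - F (j - 1))"
  proof (rule mult_left_mono)
    show "- ((k j + k (j - 1)) * (u j / m j)) \<le> F j - F (j - 1)"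
      using left right j by (simp add: F algebra_simps)
  qed (use s h[OF j] in simp)
  also have "\<dots> = u j - r j"
    using step[OF j] s h[OF j] by (simp add: field_simps)
  finally show ?thesis by simp
qed

lemma Q1_pos: "Q1 V W N xh x v > 0"
  by (simp add: Q1_def)

definition conductance ::
  "(real \<Rightarrow> real) \<Rightarrow> (real \<Rightarrow> real) \<Rightarrow> nat \<Rightarrow> (nat \<Rightarrow> real) \<Rightarrow> (nat \<Rightarrow> real) \<Rightarrow> nat \<Rightarrow> real"
where
  "conductance V W N xh v j =
     (if 1 \<le> j \<and> j < N then Q1 V W N xh (xh j) v / half_size xh j else 0)"

lemma conductance_boundary: "conductance V W N xh v 0 = 0" "conductance V W N xh v N = 0"
  by (simp_all add: conductance_def)

lemma conductance_nonneg:
  assumes "is_mesh a b N xh"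
  shows "conductance V W N xh v j \<ge> 0"
proof (cases "1 \<le> j \<and> j < N")
  case True
  then have "half_size xh j > 0"
    using cell_size_pos[OF assms, of j] cell_size_pos[OF assms, of "j + 1"]
    by (simp add: half_size_def)
  then show ?thesis using Q1_pos[of V W N xh "xh j" v] by (simp add: conductance_def)
qed (auto simp: conductance_def)

lemma flux_conductance:
  "flux V W N xh v u j = conductance V W N xh v j *
     (u (j + 1) / Q1 V W N xh (cell_center xh (j + 1)) v - u j / Q1 V W N xh (cell_center xh j) v)"
  by (simp add: flux_def conductance_def)

lemma two_step_positivity:
  assumes mesh: "is_mesh a b N xh" and r: "\<And>j. j \<in> {1..N} \<Longrightarrow> r j \<ge> 0"
  shows "\<exists>\<tau>0>0. \<forall>\<tau>. 0 < \<tau> \<and> \<tau> < \<tau>0 \<longrightarrow>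
           (\<forall>r'. two_step_scheme V W N xh \<tau> rp r r' \<longrightarrow> (\<forall>j\<in>{1..N}. r' j \<ge> 0))"
proof -
  define v where "v = (\<lambda>i. 3 / 2 * r i - 1 / 2 * rp i)"
  define m where "m j = Q1 V W N xh (cell_center xh j) v" for j
  define k where "k = conductance V W N xh v"
  define c where "c j = (k j + k (j - 1)) / (cell_size xh j * m j)" for j
  \<comment> \<open>Every outflow rate \<open>c j\<close> is at most \<open>C\<close>; the summand 1 only keeps \<open>C\<close> from vanishing.\<close>
  define C where "C = 1 + (\<Sum>j=1..N. c j)"
  have h: "\<And>j. j \<in> {1..N} \<Longrightarrow> cell_size xh j > 0" by (rule cell_size_pos[OF mesh])
  have m: "\<And>j. m j > 0" by (simp add: m_def Q1_pos)
  have k: "\<And>j. k j \<ge> 0" "k 0 = 0" "k N = 0"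
    by (simp_all add: k_def conductance_nonneg[OF mesh] conductance_boundary)
  have c: "c j \<ge> 0" if "j \<in> {1..N}" for j
    using h[OF that] m[of j] k(1) by (simp add: c_def)
  then have C: "C > 0" unfolding C_def by (intro add_pos_nonneg sum_nonneg) auto
  have cC: "c j \<le> C" if "j \<in> {1..N}" for j
    using member_le_sum[of j "{1..N}" c] c that by (simp add: C_def)
  have "r' j \<ge> 0"
    if \<tau>: "0 < \<tau>" "\<tau> < 2 / C" and step: "two_step_scheme V W N xh \<tau> rp r r'" and j: "j \<in> {1..N}"
    for \<tau> r' j
  proof -
    obtain rs where
      rs: "\<And>j. j \<in> {1..N} \<Longrightarrow> (rs j - r j) / (\<tau> / 2) =
        (flux V W N xh v rs j - flux V W N xh v rs (j - 1)) / cell_size xh j"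
      and r': "\<And>j. j \<in> {1..N} \<Longrightarrow> r' j = 2 * rs j - r j"
      using step unfolding two_step_scheme_def Let_def v_def by blast
    have "\<tau> / 2 * c j \<le> \<tau> / 2 * C" using cC[OF j] \<tau>(1) by simp
    also have "\<dots> \<le> 1" using \<tau>(2) C by (simp add: field_simps)
    finally have small: "\<tau> / 2 * ((k j + k (j - 1)) / (cell_size xh j * m j)) \<le> 1"
      by (simp add: c_def)
    have F: "\<And>j. flux V W N xh v rs j = k j * (rs (j + 1) / m (j + 1) - rs j / m j)"
      by (simp add: flux_conductance k_def m_def)
    have "2 * rs j - r j \<ge> 0"
      by (rule extrapolated_step_nonneg[OF h m k _ r F rs j small]) (use \<tau> in auto)
    then show ?thesis using r'[OF j] by simp
  qed
  then show ?thesis using C by (intro exI[of _ "2 / C"]) auto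
qed

theorem theorem5p1:
  fixes V W :: "real \<Rightarrow> real" and a b :: real and N :: nat and xh :: "nat \<Rightarrow> real"
  assumes "\<And>x. W x = W (- x)"
    and "is_mesh a b N xh"
  shows
    "(\<forall>(\<tau>::real) (\<rho>0::real \<Rightarrow> real) (\<rho>::nat \<Rightarrow> nat \<Rightarrow> real).
        \<tau> > 0 \<and>
        set_integrable lebesgue {a..b} \<rho>0 \<and>
        cell_averages N xh \<rho>0 (\<rho> 0) \<and>
        first_order_step V W N xh \<tau> (\<rho> 0) (\<rho> 1) \<and>
        (\<forall>n\<ge>1. two_step_scheme V W N xh \<tau> (\<rho> (n - 1)) (\<rho> n) (\<rho> (n + 1))) \<longrightarrow>
        (\<forall>n\<ge>1. (\<Sum>j=1..N. cell_size xh j * \<rho> n j) = (LINT x:{a..b}|lebesgue. \<rho>0 x)))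
     \<and>
     (\<forall>rprev r :: nat \<Rightarrow> real.
        (\<forall>j\<in>{1..N}. r j \<ge> 0) \<longrightarrow>
        (\<exists>\<tau>0>0. \<forall>\<tau>. 0 < \<tau> \<and> \<tau> < \<tau>0 \<longrightarrow>
           (\<forall>rnext. two_step_scheme V W N xh \<tau> rprev r rnext \<longrightarrow>
              (\<forall>j\<in>{1..N}. rnext j \<ge> 0))))"
proof (intro conjI allI impI, goal_cases)
  case (1 \<tau> \<rho>0 \<rho> n)
  then show ?case using two_step_mass_conservation[OF assms(2)] by blast
next
  case (2 rprev r)
  then show ?case using two_step_positivity[OF assms(2)] by blast
qed

end
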